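(* If $c(s_i,s_j)=-\log\frac{d^E_s(s_i)}{d^I_s(s_i)}$ and $\epsilon_2=1$, then, as $\epsilon_1\to 0$, the PW-DICE dual problem with KL divergence $$\min_{\lambda}\ \epsilon_1\log \mathbb{E}_{s_i\sim I,\, s_j\sim E}\exp\Big(\tfrac{\lambda_{i+|S|}+\lambda_{j+2|S|}-c(s_i,s_j)}{\epsilon_1}\Big)+\epsilon_2\log \mathbb{E}_{(s_i,a_j)\sim I}\exp\Big(\tfrac{-\gamma\, \mathbb{E}_{s_k\sim p(\cdot|s_i,a_j)}\lambda_k+\lambda_i-\lambda_{i+|S|}}{\epsilon_2}\Big)-\Big[(1-\gamma)\mathbb{E}_{s_i\sim p_0}\lambda_i+\mathbb{E}_{s_i\sim E}\lambda_{i+2|S|}\Big]$$ is equivalent to the SMODICE objective with KL divergence, $$\min_V\ (1-\gamma)\mathbb{E}_{s\sim p_0}[V(s)]+\log \mathbb{E}_{(s,a)\sim I}\exp\Big(\log\tfrac{d^E_s(s)}{d^I_s(s)}+\gamma\, \mathbb{E}_{s'\sim p(\cdot|s,a)}V(s')-V(s)\Big).$$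
   Context: Consider an infinite-horizon Markov decision process with state space $S$ (states written $s_1,s_2,\dots,s_{|S|}$), action space $A$, transition probabilities $p(s'|s,a)$, initial state distribution $p_0$ on $S$, and discount factor $\gamma\in(0,1)$. For a policy $\pi$, the state-action occupancy is $d^\pi_{sa}(s,a)=(1-\gamma)\sum_{t\ge0}\gamma^t\Pr(s_t=s,a_t=a)$ and the state occupancy is $d^\pi_s(s)=(1-\gamma)\sum_{t\ge0}\gamma^t\Pr(s_t=s)$. $I$ is a task-agnostic dataset of state-action trajectories, generated by an average policy $\pi^I$ with occupancies $d^I_{sa}$ and $d^I_s$; $E$ is an expert dataset of state-only trajectories, generated by an expert policy $\pi^E$ with state occupancy $d^E_s$. The notation $s\sim I$, $(s,a)\sim I$, $s\sim E$ means sampling from $d^I_s$, $d^I_{sa}$, $d^E_s$ respectively, and in $\mathbb{E}_{s_i\sim I,\,s_j\sim E}$ the two states are sampled independently. $c:S\times S\to\mathbb{R}$ is the matching cost of the Wasserstein distance, and $\epsilon_1,\epsilon_2>0$ are regularization coefficients. The dual variable is $\lambda\in\mathbb{R}^{3|S|}$; the entries $\lambda_i,\lambda_{i+|S|},\lambda_{i+2|S|}$ are attached to the state $s_i$. The PW-DICE dual problem arises by duality from minimizing $\sum_{s,s'}\Pi(s,s')c(s,s')+\epsilon_1\mathrm{KL}(\Pi\|U)+\epsilon_2\mathrm{KL}(d^\pi_{sa}\|d^I_{sa})$, with $U$ the product distribution of $d^I_s$ and $d^E_s$, over policies $\pi$ and couplings $\Pi\ge 0$ with marginals $\sum_{s'}\Pi(s,s')=d^\pi_s(s)$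 and $\sum_{s}\Pi(s,s')=d^E_s(s')$. In the SMODICE objective, $V:S\to\mathbb{R}$ is a value function. "Equivalent" is the word used in the original statement, for the two optimization problems in the limit; no specific mode of convergence is stated. *)

theory Defs
  imports "HOL-Analysis.Analysis" "HOL-Probability.Probability"
begin

text \<open>
  A Markov decision process with finite state type \<open>'s\<close> and discrete action type \<open>'a\<close> is given
  by an initial distribution \<open>p0 :: 's pmf\<close>, a transition kernel \<open>p :: 's \<Rightarrow> 'a \<Rightarrow> 's pmf\<close> and a
  discount factor \<open>\<gamma>\<close>; a policy is a function \<open>\<pi> :: 's \<Rightarrow> 'a pmf\<close>.
\<close>

subsection \<open>Occupancies\<close>

text \<open>The laws of \<open>s_t\<close> and of \<open>(s_t, a_t)\<close> when actions are drawn from \<open>\<pi>\<close>.\<close>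

primrec state_dist :: "'s pmf \<Rightarrow> ('s \<Rightarrow> 'a \<Rightarrow> 's pmf) \<Rightarrow> ('s \<Rightarrow> 'a pmf) \<Rightarrow> nat \<Rightarrow> 's pmf" where
  "state_dist p0 p \<pi> 0 = p0"
| "state_dist p0 p \<pi> (Suc t) =
     bind_pmf (state_dist p0 p \<pi> t) (\<lambda>s. bind_pmf (\<pi> s) (\<lambda>a. p s a))"

definition state_action_dist ::
  "'s pmf \<Rightarrow> ('s \<Rightarrow> 'a \<Rightarrow> 's pmf) \<Rightarrow> ('s \<Rightarrow> 'a pmf) \<Rightarrow> nat \<Rightarrow> ('s \<times> 'a) pmf" where
  "state_action_dist p0 p \<pi> t =
     bind_pmf (state_dist p0 p \<pi> t) (\<lambda>s. map_pmf (\<lambda>a. (s, a)) (\<pi> s))"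

text \<open>
  The mass function is a probability mass function only for \<open>0 \<le> \<gamma> < 1\<close>; the lemma
  \<open>pmf_discounted\<close> below shows that \<open>embed_pmf\<close> is meaningful there.
\<close>

definition discounted :: "real \<Rightarrow> (nat \<Rightarrow> 'x pmf) \<Rightarrow> 'x pmf" where
  "discounted \<gamma> X = embed_pmf (\<lambda>x. (1 - \<gamma>) * (\<Sum>t. \<gamma> ^ t * pmf (X t) x))"

definition state_occupancy ::
  "real \<Rightarrow> 's pmf \<Rightarrow> ('s \<Rightarrow> 'a \<Rightarrow> 's pmf) \<Rightarrow> ('s \<Rightarrow> 'a pmf) \<Rightarrow> 's pmf" where
  "state_occupancy \<gamma> p0 p \<pi> = discounted \<gamma> (state_dist p0 p \<pi>)"

definition state_action_occupancy ::
  "real \<Rightarrow> 's pmf \<Rightarrow> ('s \<Rightarrow> 'a \<Rightarrow> 's pmf) \<Rightarrow> ('s \<Rightarrow> 'a pmf) \<Rightarrow> ('s \<times> 'a) pmf" where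
  "state_action_occupancy \<gamma> p0 p \<pi> = discounted \<gamma> (state_action_dist p0 p \<pi>)"

lemma pmf_discounted:
  assumes "0 \<le> \<gamma>" "\<gamma> < 1"
  shows "pmf (discounted \<gamma> X) x = (1 - \<gamma>) * (\<Sum>t. \<gamma> ^ t * pmf (X t) x)"
proof -
  have geo: "summable (\<lambda>t. \<gamma> ^ t)" "(\<Sum>t. (1 - \<gamma>) * \<gamma> ^ t) = 1"
    using assms by (simp_all add: suminf_mult suminf_geometric summable_geometric)
  have summ: "summable (\<lambda>t. \<gamma> ^ t * pmf (X t) y)" for y
    by (rule summable_comparison_test'[OF geo(1), of 0])
       (use assms in \<open>simp add: abs_mult mult_left_le pmf_le_1\<close>)
  have nonneg: "0 \<le> (1 - \<gamma>) * (\<Sum>t. \<gamma> ^ t * pmf (X t) y)" for y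
    using assms summ[of y] by (intro mult_nonneg_nonneg suminf_nonneg) auto
  have eq: "ennreal ((1 - \<gamma>) * (\<Sum>t. \<gamma> ^ t * pmf (X t) y))
      = (\<Sum>t. ennreal ((1 - \<gamma>) * \<gamma> ^ t) * ennreal (pmf (X t) y))" for y
  proof -
    have "(1 - \<gamma>) * (\<Sum>t. \<gamma> ^ t * pmf (X t) y) = (\<Sum>t. (1 - \<gamma>) * (\<gamma> ^ t * pmf (X t) y))"
      using summ[of y] by (rule suminf_mult[symmetric])
    moreover have "(\<Sum>t. ennreal ((1 - \<gamma>) * (\<gamma> ^ t * pmf (X t) y)))
        = ennreal (\<Sum>t. (1 - \<gamma>) * (\<gamma> ^ t * pmf (X t) y))"
      using assms summ[of y] by (intro suminf_ennreal2 summable_mult) auto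
    ultimately show ?thesis
      using assms by (simp add: ennreal_mult'[symmetric] mult.assoc)
  qed
  have "(\<integral>\<^sup>+ y. ennreal ((1 - \<gamma>) * (\<Sum>t. \<gamma> ^ t * pmf (X t) y)) \<partial>count_space UNIV)
      = (\<Sum>t. \<integral>\<^sup>+ y. ennreal ((1 - \<gamma>) * \<gamma> ^ t) * ennreal (pmf (X t) y) \<partial>count_space UNIV)"
    unfolding eq by (rule nn_integral_suminf) auto
  also have "\<dots> = (\<Sum>t. ennreal ((1 - \<gamma>) * \<gamma> ^ t))"
    by (simp add: nn_integral_cmult nn_integral_pmf measure_pmf.emeasure_space_1[simplified])
  also have "\<dots> = ennreal (\<Sum>t. (1 - \<gamma>) * \<gamma> ^ t)"
    using assms geo(1) by (intro suminf_ennreal2 summable_mult) auto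
  also have "\<dots> = 1" by (simp add: geo(2))
  finally show ?thesis
    unfolding discounted_def using nonneg by (subst pmf_embed_pmf) auto
qed

subsection \<open>The two objectives\<close>

text \<open>
  The dual variable is indexed by three copies of the state space: for the state \<open>s\<close> enumerated
  as \<open>s_i\<close>, the components \<open>Inl s\<close>, \<open>Inr (Inl s)\<close> and \<open>Inr (Inr s)\<close> are \<open>\<lambda>_i\<close>, \<open>\<lambda>_(i+|S|)\<close>
  and \<open>\<lambda>_(i+2|S|)\<close>.
\<close>

type_synonym 's dual_var = "real ^ ('s + 's + 's)"

abbreviation dual1 :: "'s::finite dual_var \<Rightarrow> 's \<Rightarrow> real" where
  "dual1 l s \<equiv> l $ Inl s"

abbreviation dual2 :: "'s::finite dual_var \<Rightarrow> 's \<Rightarrow> real" where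
  "dual2 l s \<equiv> l $ Inr (Inl s)"

abbreviation dual3 :: "'s::finite dual_var \<Rightarrow> 's \<Rightarrow> real" where
  "dual3 l s \<equiv> l $ Inr (Inr s)"

definition pw_dice_dual ::
  "real \<Rightarrow> 's::finite pmf \<Rightarrow> ('s \<Rightarrow> 'a \<Rightarrow> 's pmf) \<Rightarrow> ('s \<Rightarrow> 'a pmf) \<Rightarrow> ('s \<Rightarrow> 'a pmf)
    \<Rightarrow> ('s \<Rightarrow> 's \<Rightarrow> real) \<Rightarrow> real \<Rightarrow> real \<Rightarrow> 's dual_var \<Rightarrow> real" where
  "pw_dice_dual \<gamma> p0 p \<pi>I \<pi>E c \<epsilon>1 \<epsilon>2 l =
     \<epsilon>1 * ln (measure_pmf.expectation
                (pair_pmf (state_occupancy \<gamma> p0 p \<pi>I) (state_occupancy \<gamma> p0 p \<pi>E))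
                (\<lambda>(si, sj). exp ((dual2 l si + dual3 l sj - c si sj) / \<epsilon>1)))
     + \<epsilon>2 * ln (measure_pmf.expectation (state_action_occupancy \<gamma> p0 p \<pi>I)
                (\<lambda>(s, a). exp ((- \<gamma> * measure_pmf.expectation (p s a) (dual1 l)
                                 + dual1 l s - dual2 l s) / \<epsilon>2)))
     - ((1 - \<gamma>) * measure_pmf.expectation p0 (dual1 l)
        + measure_pmf.expectation (state_occupancy \<gamma> p0 p \<pi>E) (dual3 l))"

definition smodice ::
  "real \<Rightarrow> 's::finite pmf \<Rightarrow> ('s \<Rightarrow> 'a \<Rightarrow> 's pmf) \<Rightarrow> ('s \<Rightarrow> 'a pmf) \<Rightarrow> ('s \<Rightarrow> 'a pmf)
    \<Rightarrow> ('s \<Rightarrow> real) \<Rightarrow> real" where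
  "smodice \<gamma> p0 p \<pi>I \<pi>E V =
     (1 - \<gamma>) * measure_pmf.expectation p0 V
     + ln (measure_pmf.expectation (state_action_occupancy \<gamma> p0 p \<pi>I)
            (\<lambda>(s, a). exp (ln (pmf (state_occupancy \<gamma> p0 p \<pi>E) s
                              / pmf (state_occupancy \<gamma> p0 p \<pi>I) s)
                           + \<gamma> * measure_pmf.expectation (p s a) V - V s)))"

text \<open>The value function read off from a dual variable; the sign comes from comparing the two
  objectives.\<close>

definition value_of :: "'s::finite dual_var \<Rightarrow> 's \<Rightarrow> real" where
  "value_of l = (\<lambda>s. - dual1 l s)"

end

theory Submission
  imports Defs
begin

text \<open>
  Since the cost depends only on the first state, the first term of the dual splits into a
  soft maximum over the dataset occupancy and one over the expert occupancy. By Jensen's inequality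
  the latter dominates the linear term in \<open>\<lambda>_(j+2|S|)\<close>. A soft maximum at temperature \<open>\<epsilon>1\<close> is
  at least the maximum minus \<open>\<epsilon>1 * K\<close> with \<open>K = - ln (min d^I)\<close>, so bounding
  \<open>\<lambda>_(i+|S|) - c\<close> by its maximum in the second term shows that the dual is at least
  \<open>F (- \<lambda>_i) - \<epsilon>1 * K\<close>. The choice \<open>\<lambda>_(i+|S|) = c\<close>, \<open>\<lambda>_(j+2|S|) = 0\<close> attains \<open>F (- \<lambda>_i)\<close>
  exactly, for every \<open>\<epsilon>1\<close>. Finally \<open>F\<close> is bounded below because Jensen's inequality and the
  Bellman flow equation make its dependence on \<open>V\<close> cancel.
\<close>

subsection \<open>Expectations of exponentials\<close>

lemma bounded_range_finite_type [simp]: "bounded (range (f :: 's::finite \<Rightarrow> real))"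
  by (simp add: finite_imp_bounded)

text \<open>The action type may be infinite, so integrability over state-action pairs is not
  automatic. Boundedness on the whole type is the criterion used throughout.\<close>

lemma integrable_pmf_bounded:
  fixes f :: "'x \<Rightarrow> real"
  assumes "bounded (range f)"
  shows "integrable (measure_pmf P) f"
proof -
  obtain B where "\<And>x. norm (f x) \<le> B"
    using assms by (auto simp: bounded_iff)
  then show ?thesis
    by (intro measure_pmf.integrable_const_bound[where B = B]) auto
qed

lemma bounded_range_exp:
  fixes h :: "'x \<Rightarrow> real"
  assumes "bounded (range h)"
  shows "bounded (range (\<lambda>x. exp (h x)))"
proof -
  obtain B where "\<And>x. norm (h x) \<le> B"
    using assms by (auto simp: bounded_iff)
  then have "norm (exp (h x)) \<le> exp B" for x
    by (simp add: abs_le_iff)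
  then show ?thesis
    by (auto simp: bounded_iff)
qed

text \<open>Jensen's inequality for \<open>exp\<close>: integrate the tangent line of
  \<open>exp\<close> at the mean \<open>\<mu>\<close>, whose linear part has expectation
  zero.\<close>

lemma expectation_exp_ge:
  fixes h :: "'x \<Rightarrow> real"
  assumes "bounded (range h)"
  shows "exp (measure_pmf.expectation P h) \<le> measure_pmf.expectation P (\<lambda>x. exp (h x))"
proof -
  define \<mu> where "\<mu> = measure_pmf.expectation P h"
  have int: "integrable (measure_pmf P) h"
    using assms by (rule integrable_pmf_bounded)
  have int_exp: "integrable (measure_pmf P) (\<lambda>x. exp (h x))"
    using assms by (intro integrable_pmf_bounded bounded_range_exp)
  have tangent: "exp \<mu> * (1 + (h x - \<mu>)) \<le> exp (h x)" for x
  proof -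
    have "exp \<mu> * (1 + (h x - \<mu>)) \<le> exp \<mu> * exp (h x - \<mu>)"
      by (intro mult_left_mono exp_ge_add_one_self) auto
    then show ?thesis
      by (simp flip: exp_add)
  qed
  have "exp \<mu> = measure_pmf.expectation P (\<lambda>x. exp \<mu> * (1 + (h x - \<mu>)))"
    using int by (simp add: \<mu>_def)
  also have "\<dots> \<le> measure_pmf.expectation P (\<lambda>x. exp (h x))"
    using int int_exp tangent by (intro integral_mono) auto
  finally show ?thesis
    by (simp add: \<mu>_def)
qed

lemma expectation_exp_pos:
  fixes h :: "'x \<Rightarrow> real"
  assumes "bounded (range h)"
  shows "0 < measure_pmf.expectation P (\<lambda>x. exp (h x))"
  using less_le_trans[OF exp_gt_zero expectation_exp_ge[OF assms]] .

lemma expectation_le_ln_exp: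
  fixes h :: "'x \<Rightarrow> real"
  assumes "bounded (range h)"
  shows "measure_pmf.expectation P h \<le> ln (measure_pmf.expectation P (\<lambda>x. exp (h x)))"
  using expectation_exp_ge[OF assms] expectation_exp_pos[OF assms] by (simp add: ln_ge_iff)

text \<open>An additive shift \<open>M\<close> of the exponent becomes a factor
  \<open>exp M\<close>, which the logarithm turns back into \<open>+ M\<close>. The comparison is
  asked only on the support, because later the shift is a maximum over the support.\<close>

lemma ln_expectation_exp_mono:
  fixes g h :: "'x \<Rightarrow> real"
  assumes "bounded (range g)" "bounded (range h)"
    and "\<And>x. x \<in> set_pmf P \<Longrightarrow> g x \<le> h x + M"
  shows "ln (measure_pmf.expectation P (\<lambda>x. exp (g x)))
    \<le> ln (measure_pmf.expectation P (\<lambda>x. exp (h x))) + M"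
proof -
  have "measure_pmf.expectation P (\<lambda>x. exp (g x))
      \<le> measure_pmf.expectation P (\<lambda>x. exp (h x) * exp M)"
    using assms
    by (intro integral_mono_AE integrable_mult_left integrable_pmf_bounded bounded_range_exp)
       (auto simp: AE_measure_pmf_iff simp flip: exp_add)
  also have "\<dots> = measure_pmf.expectation P (\<lambda>x. exp (h x)) * exp M"
    by simp
  finally have "ln (measure_pmf.expectation P (\<lambda>x. exp (g x)))
      \<le> ln (measure_pmf.expectation P (\<lambda>x. exp (h x)) * exp M)"
    using assms by (simp add: expectation_exp_pos)
  also have "\<dots> = ln (measure_pmf.expectation P (\<lambda>x. exp (h x))) + M"
    using expectation_exp_pos[OF assms(2), of P] by (simp add: ln_mult)
  finally show ?thesis .
qed

section \<open>Expectations over a finite state space\<close>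

lemma expectation_finite_type:
  fixes f :: "'s::finite \<Rightarrow> real"
  shows "measure_pmf.expectation P f = (\<Sum>s\<in>UNIV. f s * pmf P s)"
  by (rule integral_measure_pmf_real) auto

text \<open>The inner expectation is a finite sum, so exchanging it with the outer integral needs
  only linearity, even when \<open>'x\<close> is infinite.\<close>

lemma expectation_bind_pmf_finite_type:
  fixes N :: "'x \<Rightarrow> 's::finite pmf" and f :: "'s \<Rightarrow> real"
  shows "measure_pmf.expectation (bind_pmf M N) f
    = measure_pmf.expectation M (\<lambda>x. measure_pmf.expectation (N x) f)"
proof -
  have "integrable (measure_pmf M) (\<lambda>x. pmf (N x) s)" for s
    by (rule measure_pmf.integrable_const_bound[where B = 1]) (auto simp: pmf_le_1)
  then show ?thesis
    by (simp add: expectation_finite_type pmf_bind)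
qed

lemma abs_expectation_le_sum:
  fixes f :: "'s::finite \<Rightarrow> real"
  shows "\<bar>measure_pmf.expectation P f\<bar> \<le> (\<Sum>s\<in>UNIV. \<bar>f s\<bar>)"
proof -
  have "\<bar>measure_pmf.expectation P f\<bar> \<le> (\<Sum>s\<in>UNIV. \<bar>f s * pmf P s\<bar>)"
    unfolding expectation_finite_type by (rule sum_abs)
  also have "\<dots> \<le> (\<Sum>s\<in>UNIV. \<bar>f s\<bar>)"
    by (intro sum_mono) (simp add: abs_mult mult_left_le pmf_le_1)
  finally show ?thesis .
qed

text \<open>The exponents under the state-action occupancy in both objectives have this shape.
  Finiteness of the state space gives a bound uniform in the action.\<close>

lemma bounded_range_backup:
  fixes V k :: "'s::finite \<Rightarrow> real"
  shows "bounded (range (\<lambda>(s, a). r * measure_pmf.expectation (p s a) V + k s))"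
proof -
  have "norm (r * measure_pmf.expectation (p s a) V + k s)
      \<le> \<bar>r\<bar> * (\<Sum>s\<in>UNIV. \<bar>V s\<bar>) + (\<Sum>s\<in>UNIV. \<bar>k s\<bar>)" for s a
  proof -
    have "\<bar>k s\<bar> \<le> (\<Sum>s\<in>UNIV. \<bar>k s\<bar>)"
      by (rule member_le_sum) auto
    moreover have "\<bar>r * measure_pmf.expectation (p s a) V\<bar> \<le> \<bar>r\<bar> * (\<Sum>s\<in>UNIV. \<bar>V s\<bar>)"
      by (simp add: abs_mult mult_left_mono abs_expectation_le_sum)
    ultimately show ?thesis
      by (simp add: abs_le_iff)
  qed
  then show ?thesis
    by (auto simp: bounded_iff)
qed

subsection \<open>The soft maximum\<close>

text \<open>The log-sum-exp function at temperature \<epsilon> with weights \<open>P\<close>; the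
  first term of the dual is of this form.\<close>

definition soft_max :: "real \<Rightarrow> 'x pmf \<Rightarrow> ('x \<Rightarrow> real) \<Rightarrow> real" where
  "soft_max \<epsilon> P f = \<epsilon> * ln (measure_pmf.expectation P (\<lambda>x. exp (f x / \<epsilon>)))"

lemma soft_max_const:
  assumes "0 < \<epsilon>"
  shows "soft_max \<epsilon> P (\<lambda>_. k) = k"
  using assms by (simp add: soft_max_def)

lemma expectation_le_soft_max:
  fixes f :: "'s::finite \<Rightarrow> real"
  assumes "0 < \<epsilon>"
  shows "measure_pmf.expectation P f \<le> soft_max \<epsilon> P f"
proof -
  have "measure_pmf.expectation P (\<lambda>x. f x / \<epsilon>)
      \<le> ln (measure_pmf.expectation P (\<lambda>x. exp (f x / \<epsilon>)))"
    by (rule expectation_le_ln_exp) simp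
  then show ?thesis
    using assms by (simp add: soft_max_def field_simps)
qed

text \<open>All terms of the expectation are nonnegative, so keeping only the one at
  \<open>x\<close> gives a lower bound.\<close>

lemma soft_max_ge:
  fixes f :: "'s::finite \<Rightarrow> real"
  assumes "0 < \<epsilon>" "x \<in> set_pmf P"
  shows "f x + \<epsilon> * ln (pmf P x) \<le> soft_max \<epsilon> P f"
proof -
  have pos: "0 < pmf P x"
    using assms(2) by (simp add: pmf_positive)
  have "exp (f x / \<epsilon>) * pmf P x \<le> (\<Sum>s\<in>UNIV. exp (f s / \<epsilon>) * pmf P s)"
    by (rule member_le_sum) auto
  then have "ln (exp (f x / \<epsilon>) * pmf P x)
      \<le> ln (measure_pmf.expectation P (\<lambda>x. exp (f x / \<epsilon>)))"
    using pos by (intro ln_mono) (auto simp: expectation_finite_type)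
  then have "f x / \<epsilon> + ln (pmf P x) \<le> ln (measure_pmf.expectation P (\<lambda>x. exp (f x / \<epsilon>)))"
    using pos by (simp add: ln_mult)
  then show ?thesis
    using assms(1) by (simp add: soft_max_def field_simps)
qed

lemma soft_max_le:
  fixes f :: "'s::finite \<Rightarrow> real"
  assumes "0 < \<epsilon>" "\<And>x. x \<in> set_pmf P \<Longrightarrow> f x \<le> M"
  shows "soft_max \<epsilon> P f \<le> M"
proof -
  have "ln (measure_pmf.expectation P (\<lambda>x. exp (f x / \<epsilon>)))
      \<le> ln (measure_pmf.expectation P (\<lambda>_. exp 0)) + M / \<epsilon>"
    using assms by (intro ln_expectation_exp_mono) (auto simp: divide_right_mono)
  then show ?thesis
    using assms(1) by (simp add: soft_max_def field_simps)
qed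

text \<open>Squeeze between the single-term bound at a maximizer \<open>x\<close> on the support and
  the maximum itself; the error \<open>\<epsilon> * ln (pmf P x)\<close> vanishes because
  \<open>pmf P x\<close> is fixed and positive.\<close>

lemma soft_max_tendsto_Max:
  fixes f :: "'s::finite \<Rightarrow> real"
  shows "((\<lambda>\<epsilon>. soft_max \<epsilon> P f) \<longlongrightarrow> Max (f ` set_pmf P)) (at_right 0)"
proof -
  have "Max (f ` set_pmf P) \<in> f ` set_pmf P"
    by (intro Max_in) (auto simp: set_pmf_not_empty)
  then obtain x where x: "x \<in> set_pmf P" "Max (f ` set_pmf P) = f x"
    by auto
  have pos: "eventually (\<lambda>\<epsilon>. 0 < \<epsilon>) (at_right (0 :: real))"
    by (simp add: eventually_at_right_less)
  show ?thesis
  proof (rule tendsto_sandwich)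
    show "eventually (\<lambda>\<epsilon>. f x + \<epsilon> * ln (pmf P x) \<le> soft_max \<epsilon> P f) (at_right 0)"
      using pos by eventually_elim (rule soft_max_ge[OF _ x(1)])
    show "eventually (\<lambda>\<epsilon>. soft_max \<epsilon> P f \<le> Max (f ` set_pmf P)) (at_right 0)"
      using pos by eventually_elim (rule soft_max_le, auto)
    have "((\<lambda>\<epsilon>. f x + \<epsilon> * ln (pmf P x)) \<longlongrightarrow> f x + 0 * ln (pmf P x)) (at_right 0)"
      by (intro tendsto_intros)
    then show "((\<lambda>\<epsilon>. f x + \<epsilon> * ln (pmf P x)) \<longlongrightarrow> Max (f ` set_pmf P)) (at_right 0)"
      by (simp add: x(2))
  qed simp
qed

text \<open>Under independence the expectation of \<open>exp\<close> of a sum factors, and both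
  factors are positive, so the logarithm splits.\<close>

lemma soft_max_pair_add:
  fixes f :: "'s::finite \<Rightarrow> real" and g :: "'t::finite \<Rightarrow> real"
  shows "soft_max \<epsilon> (pair_pmf P Q) (\<lambda>(x, y). f x + g y) = soft_max \<epsilon> P f + soft_max \<epsilon> Q g"
proof -
  have "measure_pmf.expectation (pair_pmf P Q) (\<lambda>(x, y). exp ((f x + g y) / \<epsilon>))
      = measure_pmf.expectation P (\<lambda>x. exp (f x / \<epsilon>))
        * measure_pmf.expectation Q (\<lambda>y. exp (g y / \<epsilon>))"
    by (simp add: pair_pmf_def expectation_bind_pmf_finite_type add_divide_distrib exp_add)
  then show ?thesis
    using expectation_exp_pos[of "\<lambda>x. f x / \<epsilon>" P] expectation_exp_pos[of "\<lambda>x. g x / \<epsilon>" Q]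
    by (simp add: soft_max_def case_prod_unfold ln_mult distrib_left)
qed

text \<open>Lets the cost be replaced by its prescribed value, which is known only on the support of
  the dataset occupancy.\<close>

lemma soft_max_cong:
  assumes "\<And>x. x \<in> set_pmf P \<Longrightarrow> f x = g x"
  shows "soft_max \<epsilon> P f = soft_max \<epsilon> P g"
proof -
  have "measure_pmf.expectation P (\<lambda>x. exp (f x / \<epsilon>))
      = measure_pmf.expectation P (\<lambda>x. exp (g x / \<epsilon>))"
    using assms by (intro integral_cong_AE) (auto simp: AE_measure_pmf_iff)
  then show ?thesis
    by (simp add: soft_max_def)
qed

subsection \<open>Occupancies\<close>

text \<open>The discounted average is the law of the process at an independent geometric time. This
  trades series manipulations for monad laws.\<close>

lemma discounted_eq_bind_geometric:
  assumes "0 < \<gamma>" "\<gamma> < 1"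
  shows "discounted \<gamma> X = bind_pmf (geometric_pmf (1 - \<gamma>)) X"
proof (rule pmf_eqI)
  fix x
  have geo: "summable (\<lambda>t. \<gamma> ^ t)"
    using assms by (simp add: summable_geometric)
  have summ: "summable (\<lambda>t. \<gamma> ^ t * pmf (X t) x)"
    by (rule summable_comparison_test'[OF geo, of 0])
       (use assms in \<open>simp add: abs_mult mult_left_le pmf_le_1\<close>)
  have eq: "pmf (geometric_pmf (1 - \<gamma>)) t * pmf (X t) x = (1 - \<gamma>) * (\<gamma> ^ t * pmf (X t) x)" for t
    using assms by simp
  have "ennreal (pmf (bind_pmf (geometric_pmf (1 - \<gamma>)) X) x)
      = (\<Sum>t. ennreal ((1 - \<gamma>) * (\<gamma> ^ t * pmf (X t) x)))"
    by (simp add: ennreal_pmf_bind nn_integral_measure_pmf nn_integral_count_space_nat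
        flip: ennreal_mult' eq)
  also have "\<dots> = ennreal (\<Sum>t. (1 - \<gamma>) * (\<gamma> ^ t * pmf (X t) x))"
    using assms summ by (intro suminf_ennreal2 summable_mult) auto
  also have "(\<Sum>t. (1 - \<gamma>) * (\<gamma> ^ t * pmf (X t) x)) = pmf (discounted \<gamma> X) x"
    using assms summ by (simp add: pmf_discounted suminf_mult)
  finally show "pmf (discounted \<gamma> X) x = pmf (bind_pmf (geometric_pmf (1 - \<gamma>)) X) x"
    by simp
qed

text \<open>The policy is stationary, so the action is drawn by the same kernel at every time and
  the draw can be moved behind the geometric time.\<close>

lemma state_action_occupancy_eq_bind:
  assumes "0 < \<gamma>" "\<gamma> < 1"
  shows "state_action_occupancy \<gamma> p0 p \<pi>
    = bind_pmf (state_occupancy \<gamma> p0 p \<pi>) (\<lambda>s. map_pmf (Pair s) (\<pi> s))"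
  using assms
  by (simp add: state_action_occupancy_def state_occupancy_def discounted_eq_bind_geometric
      state_action_dist_def[abs_def] bind_assoc_pmf)

lemma map_fst_state_action_occupancy:
  assumes "0 < \<gamma>" "\<gamma> < 1"
  shows "map_pmf fst (state_action_occupancy \<gamma> p0 p \<pi>) = state_occupancy \<gamma> p0 p \<pi>"
  using assms
  by (simp add: state_action_occupancy_eq_bind map_bind_pmf pmf.map_comp o_def bind_return_pmf')

text \<open>Condition on whether the geometric time is zero. With probability
  \<open>1 - \<gamma>\<close> it is, and the state has law \<open>p0\<close>; otherwise, by
  memorylessness, one transition follows a pair drawn from the state-action occupancy.\<close>

lemma state_occupancy_unfold:
  assumes "0 < \<gamma>" "\<gamma> < 1"
  shows "state_occupancy \<gamma> p0 p \<pi> = bind_pmf (bernoulli_pmf (1 - \<gamma>))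
    (\<lambda>b. if b then p0 else bind_pmf (state_action_occupancy \<gamma> p0 p \<pi>) (\<lambda>(s, a). p s a))"
proof -
  let ?G = "geometric_pmf (1 - \<gamma>)"
  have "bind_pmf (if b then return_pmf 0 else map_pmf Suc ?G) (state_dist p0 p \<pi>)
      = (if b then p0 else bind_pmf (state_action_occupancy \<gamma> p0 p \<pi>) (\<lambda>(s, a). p s a))" for b
    using assms
    by (simp add: state_action_occupancy_eq_bind state_occupancy_def discounted_eq_bind_geometric
        bind_map_pmf bind_return_pmf bind_assoc_pmf)
  moreover have "?G = bind_pmf (bernoulli_pmf (1 - \<gamma>))
      (\<lambda>b. if b then return_pmf 0 else map_pmf Suc ?G)"
    using assms by (intro geometric_bind_pmf_unfold) auto
  then have "bind_pmf ?G (state_dist p0 p \<pi>) = bind_pmf (bernoulli_pmf (1 - \<gamma>))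
      (\<lambda>b. bind_pmf (if b then return_pmf 0 else map_pmf Suc ?G) (state_dist p0 p \<pi>))"
    unfolding bind_assoc_pmf[symmetric] by simp
  ultimately show ?thesis
    using assms by (simp add: state_occupancy_def discounted_eq_bind_geometric)
qed

lemma bellman_flow:
  fixes p0 :: "'s::finite pmf"
  assumes "0 < \<gamma>" "\<gamma> < 1"
  shows "measure_pmf.expectation (state_occupancy \<gamma> p0 p \<pi>) V
    = (1 - \<gamma>) * measure_pmf.expectation p0 V
      + \<gamma> * measure_pmf.expectation (state_action_occupancy \<gamma> p0 p \<pi>)
               (\<lambda>(s, a). measure_pmf.expectation (p s a) V)"
  using assms
  by (subst state_occupancy_unfold)
     (simp_all add: expectation_bind_pmf_finite_type case_prod_unfold algebra_simps)

subsection \<open>Equivalence of a perturbed problem\<close>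

text \<open>Here \<open>v\<close> projects the larger variable to the smaller one and
  \<open>u\<close> is a section of it. The first two assumptions say that, up to an error
  \<open>K * \<epsilon>\<close>, minimizing \<open>J \<epsilon>\<close> over each fibre of
  \<open>v\<close> gives \<open>F\<close>, with \<open>u V\<close> reaching the value
  \<open>F V\<close> exactly.\<close>

locale perturbed_problem =
  fixes J :: "real \<Rightarrow> 'l \<Rightarrow> real" and J0 :: "'l \<Rightarrow> real" and F :: "'v \<Rightarrow> real"
    and v :: "'l \<Rightarrow> 'v" and u :: "'v \<Rightarrow> 'l" and K :: real
  assumes lower: "0 < \<epsilon> \<Longrightarrow> F (v l) - K * \<epsilon> \<le> J \<epsilon> l"
    and section_value: "0 < \<epsilon> \<Longrightarrow> J \<epsilon> (u V) = F V"
    and is_section: "v (u V) = V"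
    and F_bdd: "bdd_below (range F)"
    and J_lim: "((\<lambda>\<epsilon>. J \<epsilon> l) \<longlongrightarrow> J0 l) (at_right 0)"
begin

lemma eventually_pos: "eventually (\<lambda>\<epsilon>. 0 < \<epsilon>) (at_right (0 :: real))"
  by (simp add: eventually_at_right_less)

lemma tendsto_minus_linear:
  assumes "(f \<longlongrightarrow> l) (at_right 0)"
  shows "((\<lambda>\<epsilon>. f \<epsilon> - K * \<epsilon>) \<longlongrightarrow> l) (at_right 0)"
proof -
  have "((\<lambda>\<epsilon>. f \<epsilon> - K * \<epsilon>) \<longlongrightarrow> l - K * 0) (at_right 0)"
    by (intro tendsto_intros assms)
  then show ?thesis
    by simp
qed

lemma INF_F_le: "(INF V. F V) \<le> F V"
  using F_bdd by (intro cINF_lower) auto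

section \<open>The limiting objective \<open>J0\<close>\<close>

lemma limit_ge: "F (v l) \<le> J0 l"
proof (rule tendsto_le)
  show "((\<lambda>\<epsilon>. F (v l) - K * \<epsilon>) \<longlongrightarrow> F (v l)) (at_right 0)"
    by (intro tendsto_minus_linear tendsto_const)
  show "eventually (\<lambda>\<epsilon>. F (v l) - K * \<epsilon> \<le> J \<epsilon> l) (at_right 0)"
    using eventually_pos by eventually_elim (rule lower)
qed (use J_lim in auto)

text \<open>Along the section, \<open>J \<epsilon> (u V)\<close> does not depend on \<epsilon> for
  positive \<epsilon>, so its limit is that constant.\<close>

lemma limit_section: "J0 (u V) = F V"
proof -
  have "((\<lambda>\<epsilon>. J \<epsilon> (u V)) \<longlongrightarrow> F V) (at_right 0)"
    by (rule tendsto_eventually)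
       (use eventually_pos in eventually_elim, rule section_value)
  then show ?thesis
    using J_lim by (intro tendsto_unique[of "at_right (0 :: real)"]) auto
qed

lemma partial_min: "is_arg_min J0 (\<lambda>l. v l = V) (u V)"
  using limit_ge by (auto simp: is_arg_min_def is_section limit_section not_less)

text \<open>Minimizers of \<open>F\<close> lift through \<open>u\<close>, where \<open>J0\<close>
  equals \<open>F\<close>. Conversely, \<open>F (v l) \<le> J0 l \<le> J0 (u V') = F V'\<close>
  whenever \<open>l\<close> minimizes \<open>J0\<close>.\<close>

lemma minimizers: "is_arg_min F (\<lambda>_. True) V \<longleftrightarrow> (\<exists>l. is_arg_min J0 (\<lambda>_. True) l \<and> v l = V)"
proof
  assume "is_arg_min F (\<lambda>_. True) V"
  then have "is_arg_min J0 (\<lambda>_. True) (u V)"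
    using limit_ge by (force simp: is_arg_min_def limit_section not_less intro: order_trans)
  then show "\<exists>l. is_arg_min J0 (\<lambda>_. True) l \<and> v l = V"
    using is_section by blast
next
  assume "\<exists>l. is_arg_min J0 (\<lambda>_. True) l \<and> v l = V"
  then obtain l where l: "\<And>l'. J0 l \<le> J0 l'" "v l = V"
    by (auto simp: is_arg_min_def not_less)
  have "F V \<le> F V'" for V'
    using limit_ge[of l] l(1)[of "u V'"] l(2) by (simp add: limit_section)
  then show "is_arg_min F (\<lambda>_. True) V"
    by (auto simp: is_arg_min_def not_less)
qed

text \<open>Ensures that the real-valued \<open>INF\<close> of \<open>J0\<close> is a genuine
  infimum.\<close>

lemma J0_bdd: "bdd_below (range J0)"
  using INF_F_le limit_ge by (intro bdd_belowI2[of _ "INF V. F V"]) (blast intro: order_trans)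

lemma INF_J0: "(INF l. J0 l) = (INF V. F V)"
proof (rule antisym)
  show "(INF l. J0 l) \<le> (INF V. F V)"
    using J0_bdd by (intro cINF_mono) (auto intro: exI[of _ "u _"] simp: limit_section)
  show "(INF V. F V) \<le> (INF l. J0 l)"
    using INF_F_le limit_ge by (intro cINF_greatest) (auto intro: order_trans)
qed

section \<open>The problems at positive \<epsilon>\<close>

lemma J_ge: "0 < \<epsilon> \<Longrightarrow> (INF V. F V) - K * \<epsilon> \<le> J \<epsilon> l"
  using INF_F_le[of "v l"] lower[of \<epsilon> l] by linarith

lemma J_bdd: "0 < \<epsilon> \<Longrightarrow> bdd_below (range (J \<epsilon>))"
  using J_ge by (intro bdd_belowI2)

lemma INF_J_ge: "0 < \<epsilon> \<Longrightarrow> (INF V. F V) - K * \<epsilon> \<le> (INF l. J \<epsilon> l)"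
  using J_ge by (intro cINF_greatest) auto

lemma INF_J_le: "0 < \<epsilon> \<Longrightarrow> (INF l. J \<epsilon> l) \<le> (INF V. F V)"
  using J_bdd by (intro cINF_mono) (auto intro: exI[of _ "u _"] simp: section_value)

lemma INF_J_tendsto: "((\<lambda>\<epsilon>. INF l. J \<epsilon> l) \<longlongrightarrow> (INF V. F V)) (at_right 0)"
proof (rule tendsto_sandwich)
  show "eventually (\<lambda>\<epsilon>. (INF V. F V) - K * \<epsilon> \<le> (INF l. J \<epsilon> l)) (at_right 0)"
    using eventually_pos by eventually_elim (rule INF_J_ge)
  show "eventually (\<lambda>\<epsilon>. (INF l. J \<epsilon> l) \<le> (INF V. F V)) (at_right 0)"
    using eventually_pos by eventually_elim (rule INF_J_le)
qed (auto intro: tendsto_minus_linear)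

text \<open>The value \<open>F (v (L \<epsilon>))\<close> lies between the infimum of
  \<open>F\<close> and \<open>J \<epsilon> (L \<epsilon>) + K * \<epsilon>\<close>. Families with
  vanishing optimality gap are used so that no minimizer has to exist.\<close>

lemma asymptotic_minimizers_project:
  assumes "((\<lambda>\<epsilon>. J \<epsilon> (L \<epsilon>) - (INF l. J \<epsilon> l)) \<longlongrightarrow> 0) (at_right 0)"
  shows "((\<lambda>\<epsilon>. F (v (L \<epsilon>))) \<longlongrightarrow> (INF V. F V)) (at_right 0)"
proof (rule tendsto_sandwich[where f = "\<lambda>_. INF V. F V"])
  have "((\<lambda>\<epsilon>. J \<epsilon> (L \<epsilon>)) \<longlongrightarrow> (INF V. F V)) (at_right 0)"
    using tendsto_add[OF assms INF_J_tendsto] by simp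
  then show "((\<lambda>\<epsilon>. J \<epsilon> (L \<epsilon>) + K * \<epsilon>) \<longlongrightarrow> (INF V. F V)) (at_right 0)"
    by (auto intro!: tendsto_eq_intros)
  show "eventually (\<lambda>\<epsilon>. F (v (L \<epsilon>)) \<le> J \<epsilon> (L \<epsilon>) + K * \<epsilon>) (at_right 0)"
    using eventually_pos
  proof eventually_elim
    case (elim \<epsilon>)
    then show ?case
      using lower[of \<epsilon> "L \<epsilon>"] by simp
  qed
qed (use INF_F_le in auto)

lemma asymptotic_minimizers_lift:
  assumes "((\<lambda>\<epsilon>. F (W \<epsilon>)) \<longlongrightarrow> (INF V. F V)) (at_right 0)"
  shows "((\<lambda>\<epsilon>. J \<epsilon> (u (W \<epsilon>)) - (INF l. J \<epsilon> l)) \<longlongrightarrow> 0) (at_right 0)"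
proof (rule Lim_transform_eventually)
  show "((\<lambda>\<epsilon>. F (W \<epsilon>) - (INF l. J \<epsilon> l)) \<longlongrightarrow> 0) (at_right 0)"
    using tendsto_diff[OF assms INF_J_tendsto] by simp
  show "eventually (\<lambda>\<epsilon>. F (W \<epsilon>) - (INF l. J \<epsilon> l) = J \<epsilon> (u (W \<epsilon>)) - (INF l. J \<epsilon> l)) (at_right 0)"
    using eventually_pos by eventually_elim (simp add: section_value)
qed

end

subsection \<open>Comparison of the objectives\<close>

text \<open>Regroups the exponent into the shape of \<open>bounded_range_backup\<close>.\<close>

lemma smodice_eq:
  "smodice \<gamma> p0 p \<pi>I \<pi>E V = (1 - \<gamma>) * measure_pmf.expectation p0 V
     + ln (measure_pmf.expectation (state_action_occupancy \<gamma> p0 p \<pi>I)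
        (\<lambda>x. exp (case x of (s, a) \<Rightarrow> \<gamma> * measure_pmf.expectation (p s a) V
          + (ln (pmf (state_occupancy \<gamma> p0 p \<pi>E) s / pmf (state_occupancy \<gamma> p0 p \<pi>I) s) - V s))))"
  by (simp add: smodice_def case_prod_unfold algebra_simps)

text \<open>The lower bound is the mean of the log-ratio \<open>k\<close> under the dataset
  occupancy. When the expert occupancy is positive on the dataset support, it is minus the KL
  divergence of the dataset occupancy from the expert occupancy.\<close>

lemma smodice_bdd_below:
  fixes p0 :: "'s::finite pmf"
  assumes "0 < \<gamma>" "\<gamma> < 1"
  shows "bdd_below (range (smodice \<gamma> p0 p \<pi>I \<pi>E))"
proof (rule bdd_belowI2)
  fix V :: "'s \<Rightarrow> real"
  let ?I = "state_occupancy \<gamma> p0 p \<pi>I" and ?A = "state_action_occupancy \<gamma> p0 p \<pi>I"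
  define k where "k s = ln (pmf (state_occupancy \<gamma> p0 p \<pi>E) s / pmf ?I s)" for s
  have marginal: "measure_pmf.expectation ?A (\<lambda>x. f (fst x)) = measure_pmf.expectation ?I f"
    for f :: "'s \<Rightarrow> real"
    using assms by (simp flip: map_fst_state_action_occupancy)
  have int1: "integrable (measure_pmf ?A)
      (\<lambda>x. measure_pmf.expectation (p (fst x) (snd x)) V)"
    using integrable_pmf_bounded[OF bounded_range_backup[of 1 p V "\<lambda>_. 0"], of ?A]
    by (simp add: case_prod_unfold)
  have int2: "integrable (measure_pmf ?A) (\<lambda>x. f (fst x))" for f :: "'s \<Rightarrow> real"
    using integrable_pmf_bounded[OF bounded_range_backup[of 0 p V f], of ?A]
    by (simp add: case_prod_unfold)
  \<comment> \<open>The Bellman flow equation cancels all terms in \<open>V\<close> on the right,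
    leaving only the mean of \<open>k\<close>.\<close>
  have "measure_pmf.expectation ?I k = (1 - \<gamma>) * measure_pmf.expectation p0 V
      + measure_pmf.expectation ?A
          (\<lambda>(s, a). \<gamma> * measure_pmf.expectation (p s a) V + (k s - V s))"
    using bellman_flow[OF assms, of p0 p \<pi>I V] int1
      int2[of k] int2[of V] marginal[of k] marginal[of V]
    by (simp add: case_prod_unfold)
  also have "\<dots> \<le> smodice \<gamma> p0 p \<pi>I \<pi>E V"
    unfolding smodice_eq k_def by (intro add_left_mono expectation_le_ln_exp bounded_range_backup)
  finally show "measure_pmf.expectation ?I k \<le> smodice \<gamma> p0 p \<pi>I \<pi>E V" .
qed

text \<open>Substituting \<open>V = - \<lambda>_i\<close> flips the signs of the backup and of the
  initial-state term, which brings them to their form in the SMODICE objective.\<close>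

lemma pw_dice_dual_eq:
  "pw_dice_dual \<gamma> p0 p \<pi>I \<pi>E c \<epsilon> 1 l =
     soft_max \<epsilon> (pair_pmf (state_occupancy \<gamma> p0 p \<pi>I) (state_occupancy \<gamma> p0 p \<pi>E))
       (\<lambda>(i, j). dual2 l i + dual3 l j - c i j)
     + ln (measure_pmf.expectation (state_action_occupancy \<gamma> p0 p \<pi>I)
         (\<lambda>x. exp (case x of (s, a) \<Rightarrow> \<gamma> * measure_pmf.expectation (p s a) (value_of l)
            + (- value_of l s - dual2 l s))))
     + (1 - \<gamma>) * measure_pmf.expectation p0 (value_of l)
     - measure_pmf.expectation (state_occupancy \<gamma> p0 p \<pi>E) (dual3 l)"
  by (simp add: pw_dice_dual_def soft_max_def value_of_def case_prod_unfold algebra_simps)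

text \<open>The section \<open>u\<close> of the abstract problem. With \<open>k\<close> the
  log-ratio of the occupancies, the second block \<open>- k\<close> is the prescribed cost.\<close>

definition dual_of_value :: "('s \<Rightarrow> real) \<Rightarrow> ('s::finite \<Rightarrow> real) \<Rightarrow> 's dual_var" where
  "dual_of_value k V = (\<chi> i. case i of Inl s \<Rightarrow> - V s | Inr (Inl s) \<Rightarrow> - k s | Inr (Inr s) \<Rightarrow> 0)"

lemma dual_of_value_simps [simp]:
  "value_of (dual_of_value k V) = V"
  "dual2 (dual_of_value k V) s = - k s"
  "dual3 (dual_of_value k V) s = 0"
  by (simp_all add: dual_of_value_def value_of_def)

text \<open>The error constant is minus the logarithm of the smallest positive dataset occupancy: it
  bounds the loss from keeping a single term of the soft maximum, whichever state is the
  maximizer.\<close>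

lemma perturbed_problem_pw_dice:
  fixes \<gamma> :: real and p0 :: "'s::finite pmf" and p :: "'s \<Rightarrow> 'a \<Rightarrow> 's pmf"
    and \<pi>I \<pi>E :: "'s \<Rightarrow> 'a pmf"
  defines "I \<equiv> state_occupancy \<gamma> p0 p \<pi>I" and "E \<equiv> state_occupancy \<gamma> p0 p \<pi>E"
  assumes \<gamma>: "0 < \<gamma>" "\<gamma> < 1"
    and cost: "\<And>si sj. si \<in> set_pmf I \<Longrightarrow> c si sj = - ln (pmf E si / pmf I si)"
  shows "\<exists>J0. perturbed_problem (\<lambda>\<epsilon>. pw_dice_dual \<gamma> p0 p \<pi>I \<pi>E c \<epsilon> 1) J0
    (smodice \<gamma> p0 p \<pi>I \<pi>E) value_of (dual_of_value (\<lambda>s. ln (pmf E s / pmf I s)))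
    (- ln (Min (pmf I ` set_pmf I)))"
proof -
  define k where "k s = ln (pmf E s / pmf I s)" for s
  define m where "m = Min (pmf I ` set_pmf I)"
  let ?A = "state_action_occupancy \<gamma> p0 p \<pi>I"
  let ?J = "\<lambda>\<epsilon>. pw_dice_dual \<gamma> p0 p \<pi>I \<pi>E c \<epsilon> 1" and ?F = "smodice \<gamma> p0 p \<pi>I \<pi>E"
  have "m \<in> pmf I ` set_pmf I"
    unfolding m_def by (intro Min_in) (auto simp: set_pmf_not_empty)
  then have m: "0 < m" "\<And>s. s \<in> set_pmf I \<Longrightarrow> m \<le> pmf I s"
    by (auto simp: m_def pmf_positive)
  \<comment> \<open>Bounds over the support of \<open>I\<close> can therefore be applied under the
    state-action occupancy, whose state marginal is \<open>I\<close>.\<close>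
  have support: "fst x \<in> set_pmf I" if "x \<in> set_pmf ?A" for x
    using that \<gamma> unfolding I_def
    by (simp flip: map_fst_state_action_occupancy[where \<gamma> = \<gamma> and \<pi> = \<pi>I])
  \<comment> \<open>On the support of \<open>I\<close> the cost is \<open>- k i\<close>, independent
    of \<open>j\<close>, so the exponent is a sum of a function of \<open>i\<close> and a function
    of \<open>j\<close>.\<close>
  have split: "soft_max \<epsilon> (pair_pmf I E) (\<lambda>(i, j). dual2 l i + dual3 l j - c i j)
      = soft_max \<epsilon> I (\<lambda>i. dual2 l i + k i) + soft_max \<epsilon> E (dual3 l)" for \<epsilon> l
    unfolding soft_max_pair_add[symmetric]
    by (rule soft_max_cong) (auto simp: cost k_def)
  have J_eq: "?J \<epsilon> l = soft_max \<epsilon> I (\<lambda>i. dual2 l i + k i) + soft_max \<epsilon> E (dual3 l)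
     + ln (measure_pmf.expectation ?A
         (\<lambda>x. exp (case x of (s, a) \<Rightarrow> \<gamma> * measure_pmf.expectation (p s a) (value_of l)
            + (- value_of l s - dual2 l s))))
     + (1 - \<gamma>) * measure_pmf.expectation p0 (value_of l)
     - measure_pmf.expectation E (dual3 l)" for \<epsilon> l
    unfolding pw_dice_dual_eq split[unfolded I_def E_def] by (simp add: I_def E_def)
  have F_eq: "?F V = (1 - \<gamma>) * measure_pmf.expectation p0 V
     + ln (measure_pmf.expectation ?A
        (\<lambda>x. exp (case x of (s, a) \<Rightarrow> \<gamma> * measure_pmf.expectation (p s a) V + (k s - V s))))" for V
    by (simp add: smodice_eq k_def I_def E_def)
  have lower: "?F (value_of l) - (- ln m) * \<epsilon> \<le> ?J \<epsilon> l" if \<epsilon>: "0 < \<epsilon>" for \<epsilon> l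
  proof -
    define M where "M = Max ((\<lambda>i. dual2 l i + k i) ` set_pmf I)"
    have "M \<in> (\<lambda>i. dual2 l i + k i) ` set_pmf I"
      unfolding M_def by (intro Max_in) (auto simp: set_pmf_not_empty)
    then obtain i where i: "i \<in> set_pmf I" "M = dual2 l i + k i"
      by auto
    have M: "dual2 l s + k s \<le> M" if "s \<in> set_pmf I" for s
      using that unfolding M_def by (intro Max_ge) auto
    have "\<epsilon> * ln m \<le> \<epsilon> * ln (pmf I i)"
      using \<epsilon> m i(1) by (intro mult_left_mono ln_mono) (auto simp: pmf_positive)
    then have "M + \<epsilon> * ln m \<le> soft_max \<epsilon> I (\<lambda>i. dual2 l i + k i)"
      using soft_max_ge[OF \<epsilon> i(1), of "\<lambda>i. dual2 l i + k i"] i(2) by linarith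
    moreover have "measure_pmf.expectation E (dual3 l) \<le> soft_max \<epsilon> E (dual3 l)"
      using \<epsilon> by (rule expectation_le_soft_max)
    \<comment> \<open>On the support, \<open>dual2 l s + k s \<le> M\<close> gives
      \<open>k s \<le> - dual2 l s + M\<close>, so the two exponents differ by at most
      \<open>M\<close>.\<close>
    moreover have "ln (measure_pmf.expectation ?A
          (\<lambda>x. exp (case x of (s, a) \<Rightarrow>
             \<gamma> * measure_pmf.expectation (p s a) (value_of l) + (k s - value_of l s))))
        \<le> ln (measure_pmf.expectation ?A
          (\<lambda>x. exp (case x of (s, a) \<Rightarrow>
             \<gamma> * measure_pmf.expectation (p s a) (value_of l) + (- value_of l s - dual2 l s)))) + M"
      using M support by (intro ln_expectation_exp_mono bounded_range_backup) fastforce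
    ultimately show ?thesis
      unfolding J_eq F_eq by (simp add: mult.commute)
  qed
  \<comment> \<open>Both soft maxima are now of the constant zero, since \<open>dual2\<close>
    cancels \<open>k\<close> and \<open>dual3\<close> vanishes.\<close>
  have section_value: "?J \<epsilon> (dual_of_value k V) = ?F V" if "0 < \<epsilon>" for \<epsilon> V
    using that by (simp add: J_eq F_eq soft_max_const algebra_simps case_prod_unfold)
  \<comment> \<open>Only the two soft maxima depend on \<epsilon>; each is replaced by the maximum
    over its support.\<close>
  define J0 where "J0 l = Max ((\<lambda>i. dual2 l i + k i) ` set_pmf I) + Max (dual3 l ` set_pmf E)
     + ln (measure_pmf.expectation ?A
         (\<lambda>x. exp (case x of (s, a) \<Rightarrow> \<gamma> * measure_pmf.expectation (p s a) (value_of l)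
            + (- value_of l s - dual2 l s))))
     + (1 - \<gamma>) * measure_pmf.expectation p0 (value_of l)
     - measure_pmf.expectation E (dual3 l)" for l
  have "((\<lambda>\<epsilon>. ?J \<epsilon> l) \<longlongrightarrow> J0 l) (at_right 0)" for l
    unfolding J_eq J0_def by (intro tendsto_intros soft_max_tendsto_Max)
  then have "perturbed_problem ?J J0 ?F value_of (dual_of_value k) (- ln m)"
    using lower section_value smodice_bdd_below[OF \<gamma>] by unfold_locales auto
  then show ?thesis
    unfolding k_def[abs_def] m_def by blast
qed

theorem claim1:
  fixes \<gamma> \<epsilon>2 :: real
    and p0 :: "'s::finite pmf"
    and p :: "'s \<Rightarrow> 'a \<Rightarrow> 's pmf"
    and \<pi>I \<pi>E :: "'s \<Rightarrow> 'a pmf"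
    and c :: "'s \<Rightarrow> 's \<Rightarrow> real"
  defines "dI \<equiv> pmf (state_occupancy \<gamma> p0 p \<pi>I)"
    and "dE \<equiv> pmf (state_occupancy \<gamma> p0 p \<pi>E)"
    and "J \<equiv> (\<lambda>\<epsilon>1. pw_dice_dual \<gamma> p0 p \<pi>I \<pi>E c \<epsilon>1 \<epsilon>2)"
    and "F \<equiv> smodice \<gamma> p0 p \<pi>I \<pi>E"
  assumes "0 < \<gamma>" "\<gamma> < 1"
    and "\<epsilon>2 = 1"
    and "\<And>s. 0 < dI s \<Longrightarrow> 0 < dE s"
    and "\<And>si sj. 0 < dI si \<Longrightarrow> c si sj = - ln (dE si / dI si)"
  shows
    \<comment> \<open>the pointwise limit of the dual problem is equivalent to the SMODICE problem\<close>
    "(\<exists>J0.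
        (\<forall>l. ((\<lambda>\<epsilon>1. J \<epsilon>1 l) \<longlongrightarrow> J0 l) (at_right 0))
      \<and> (\<forall>V. \<exists>l. is_arg_min J0 (\<lambda>l'. value_of l' = V) l \<and> J0 l = F V)
      \<and> (\<forall>V. is_arg_min F (\<lambda>_. True) V
              \<longleftrightarrow> (\<exists>l. is_arg_min J0 (\<lambda>_. True) l \<and> value_of l = V))
      \<and> bdd_below (range J0) \<and> (INF l. J0 l) = (INF V. F V))
     \<comment> \<open>the optimal values converge\<close>
   \<and> (\<forall>\<epsilon>1>0. bdd_below (range (J \<epsilon>1))) \<and> bdd_below (range F)
   \<and> ((\<lambda>\<epsilon>1. INF l. J \<epsilon>1 l) \<longlongrightarrow> (INF V. F V)) (at_right 0)
     \<comment> \<open>asymptotically optimal solutions correspond to each other\<close>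
   \<and> (\<forall>L. ((\<lambda>\<epsilon>1. J \<epsilon>1 (L \<epsilon>1) - (INF l. J \<epsilon>1 l)) \<longlongrightarrow> 0) (at_right 0)
          \<longrightarrow> ((\<lambda>\<epsilon>1. F (value_of (L \<epsilon>1))) \<longlongrightarrow> (INF V. F V)) (at_right 0))
   \<and> (\<forall>W. ((\<lambda>\<epsilon>1. F (W \<epsilon>1)) \<longlongrightarrow> (INF V. F V)) (at_right 0)
          \<longrightarrow> (\<exists>L. (\<forall>\<epsilon>1>0. value_of (L \<epsilon>1) = W \<epsilon>1)
                \<and> ((\<lambda>\<epsilon>1. J \<epsilon>1 (L \<epsilon>1) - (INF l. J \<epsilon>1 l)) \<longlongrightarrow> 0) (at_right 0)))"
proof -
  define u where "u = dual_of_value (\<lambda>s. ln (dE s / dI s))"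
  obtain J0 where "perturbed_problem J J0 F value_of u
      (- ln (Min (dI ` set_pmf (state_occupancy \<gamma> p0 p \<pi>I))))"
    using perturbed_problem_pw_dice[of \<gamma> p0 p \<pi>I c \<pi>E] assms
    unfolding u_def by (auto simp: pmf_positive)
  then interpret perturbed_problem J J0 F value_of u
      "- ln (Min (dI ` set_pmf (state_occupancy \<gamma> p0 p \<pi>I)))" .
  \<comment> \<open>The witness lifts \<open>W\<close> through the section at each \<epsilon>, so
    its projection is \<open>W\<close> itself.\<close>
  have "\<exists>L. (\<forall>\<epsilon>1>0. value_of (L \<epsilon>1) = W \<epsilon>1)
      \<and> ((\<lambda>\<epsilon>1. J \<epsilon>1 (L \<epsilon>1) - (INF l. J \<epsilon>1 l)) \<longlongrightarrow> 0) (at_right 0)"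
    if "((\<lambda>\<epsilon>1. F (W \<epsilon>1)) \<longlongrightarrow> (INF V. F V)) (at_right 0)" for W
    using asymptotic_minimizers_lift[OF that] is_section
    by (intro exI[of _ "\<lambda>\<epsilon>. u (W \<epsilon>)"]) simp
  moreover have "\<exists>l. is_arg_min J0 (\<lambda>l'. value_of l' = V) l \<and> J0 l = F V" for V
    using partial_min limit_section by blast
  ultimately show ?thesis
    using J_lim minimizers J0_bdd INF_J0 J_bdd F_bdd INF_J_tendsto asymptotic_minimizers_project
    by (intro conjI exI[of _ J0] allI impI) blast+
qed

end
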